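(* Let $\mathbb{F}$ be a field, $X,Y,Z$ finite sets, and $F:X\times Y\times Z\to\mathbb{F}$. If $\operatorname{slice-rank}(F)<\min(\lvert X\rvert,\lvert Y\rvert,\lvert Z\rvert)$, then $F$ is unstable.
   Context: The slice rank of $F$ is the least $k$ such that $F(x,y,z)=\sum_{i=1}^a f_i(x,y)g_i(z)+\sum_{i=a+1}^b f_i(x,z)g_i(y)+\sum_{i=b+1}^k f_i(y,z)g_i(x)$ for some $0\le a\le b\le k$ and $\mathbb{F}$-valued functions $f_i,g_i$. $F$ is unstable if there exist a basis $\{f_a\}_{a\in A}$ of the $\mathbb{F}$-vector space of functions $X\to\mathbb{F}$, a basis $\{g_b\}_{b\in B}$ of functions $Y\to\mathbb{F}$, a basis $\{h_c\}_{c\in C}$ of functions $Z\to\mathbb{F}$, real weights $u_a,v_b,w_c$ with arithmetic means $u_{\mathrm{avg}},v_{\mathrm{avg}},w_{\mathrm{avg}}$, and coefficients $r_{a,b,c}\in\mathbb{F}$ such that $F(x,y,z)=\sum_{u_a+v_b+w_c<u_{\mathrm{avg}}+v_{\mathrm{avg}}+w_{\mathrm{avg}}} r_{a,b,c}f_a(x)g_b(y)h_c(z)$. *)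

theory Defs
  imports Complex_Main "HOL-Library.Function_Algebras"
begin

text \<open>A function \<open>F\<close> on a finite set \<open>X \<times> Y \<times> Z\<close> is a total function of which only the values on
  \<open>X \<times> Y \<times> Z\<close> are ever used. As the factors \<open>f\<^sub>i\<close> of the three kinds of slices live on different
  domains, they are three separate families here.\<close>

definition slice_decomposition ::
  "'x set \<Rightarrow> 'y set \<Rightarrow> 'z set \<Rightarrow> ('x \<times> 'y \<times> 'z \<Rightarrow> 'k::field) \<Rightarrow> nat \<Rightarrow> bool" where
  "slice_decomposition X Y Z F k \<longleftrightarrow>
    (\<exists>a b. a \<le> b \<and> b \<le> k \<and>
      (\<exists>(f :: nat \<Rightarrow> 'x \<times> 'y \<Rightarrow> 'k) (f' :: nat \<Rightarrow> 'x \<times> 'z \<Rightarrow> 'k) (f'' :: nat \<Rightarrow> 'y \<times> 'z \<Rightarrow> 'k)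
         (g :: nat \<Rightarrow> 'z \<Rightarrow> 'k) (g' :: nat \<Rightarrow> 'y \<Rightarrow> 'k) (g'' :: nat \<Rightarrow> 'x \<Rightarrow> 'k).
        \<forall>x\<in>X. \<forall>y\<in>Y. \<forall>z\<in>Z.
          F (x, y, z) =
            (\<Sum>i = 1..a. f i (x, y) * g i z) +
            (\<Sum>i = a + 1..b. f' i (x, z) * g' i y) +
            (\<Sum>i = b + 1..k. f'' i (y, z) * g'' i x)))"

definition slice_rank ::
  "'x set \<Rightarrow> 'y set \<Rightarrow> 'z set \<Rightarrow> ('x \<times> 'y \<times> 'z \<Rightarrow> 'k::field) \<Rightarrow> nat" where
  "slice_rank X Y Z F = (LEAST k. slice_decomposition X Y Z F k)"

text \<open>The least element exists when \<open>Z\<close> is finite: slice along the points of \<open>Z\<close>.\<close>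

lemma slice_decomposition_card:
  fixes F :: "'x \<times> 'y \<times> 'z \<Rightarrow> 'k::field"
  assumes "finite Z"
  shows "slice_decomposition X Y Z F (card Z)"
proof -
  obtain e where e: "bij_betw e {1..card Z} Z"
    using assms by (metis bij_betw_iff_card card_atLeastAtMost diff_Suc_1 finite_atLeastAtMost)
  have "F (x, y, z) = (\<Sum>i = 1..card Z. F (x, y, e i) * (if e i = z then 1 else 0))"
    if "z \<in> Z" for x y z
  proof -
    have "(\<Sum>i = 1..card Z. F (x, y, e i) * (if e i = z then 1 else 0)) =
        (\<Sum>t\<in>Z. F (x, y, t) * (if t = z then 1 else 0))"
      by (rule sum.reindex_bij_betw[OF e])
    also have "\<dots> = (\<Sum>t\<in>Z. if t = z then F (x, y, t) else 0)"
      by (rule sum.cong) auto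
    also have "\<dots> = F (x, y, z)"
      using that assms by simp
    finally show ?thesis by simp
  qed
  then show ?thesis
    unfolding slice_decomposition_def
    by (intro exI[of _ "card Z"] conjI order_refl
        exI[of _ "\<lambda>i (x, y). F (x, y, e i)"] exI[of _ "\<lambda>i z. if e i = z then 1 else 0"] exI) auto
qed

text \<open>Functions \<open>X \<rightarrow> \<FF>\<close> are represented by their extensions by zero, which form a
  subspace of the vector space of all functions on the underlying type.\<close>

definition fscale :: "'k::field \<Rightarrow> ('x \<Rightarrow> 'k) \<Rightarrow> 'x \<Rightarrow> 'k" where
  "fscale c f = (\<lambda>x. c * f x)"

interpretation fvs: vector_space fscale
  by unfold_locales (auto simp: fscale_def fun_eq_iff algebra_simps)

definition functions_on :: "'x set \<Rightarrow> ('x \<Rightarrow> 'k::field) set" where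
  "functions_on X = {f. \<forall>x. x \<notin> X \<longrightarrow> f x = 0}"

definition basis_family :: "'x set \<Rightarrow> 'i set \<Rightarrow> ('i \<Rightarrow> 'x \<Rightarrow> 'k::field) \<Rightarrow> bool" where
  "basis_family X A f \<longleftrightarrow>
    inj_on f A \<and> fvs.independent (f ` A) \<and> fvs.span (f ` A) = functions_on X"

definition mean :: "'i set \<Rightarrow> ('i \<Rightarrow> real) \<Rightarrow> real" where
  "mean A u = (\<Sum>a\<in>A. u a) / real (card A)"

text \<open>The index sets \<open>A\<close>, \<open>B\<close>, \<open>C\<close> of bases have the same finite cardinalities as \<open>X\<close>, \<open>Y\<close>, \<open>Z\<close>, so
  taking them to be sets of natural numbers is no restriction.\<close>

definition unstable ::
  "'x set \<Rightarrow> 'y set \<Rightarrow> 'z set \<Rightarrow> ('x \<times> 'y \<times> 'z \<Rightarrow> 'k::field) \<Rightarrow> bool" where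
  "unstable X Y Z F \<longleftrightarrow>
    (\<exists>(A :: nat set) (B :: nat set) (C :: nat set)
       (f :: nat \<Rightarrow> 'x \<Rightarrow> 'k) (g :: nat \<Rightarrow> 'y \<Rightarrow> 'k) (h :: nat \<Rightarrow> 'z \<Rightarrow> 'k)
       (u :: nat \<Rightarrow> real) (v :: nat \<Rightarrow> real) (w :: nat \<Rightarrow> real)
       (r :: nat \<Rightarrow> nat \<Rightarrow> nat \<Rightarrow> 'k).
      basis_family X A f \<and> basis_family Y B g \<and> basis_family Z C h \<and>
      (\<forall>x\<in>X. \<forall>y\<in>Y. \<forall>z\<in>Z.
        F (x, y, z) =
          (\<Sum>(a, b, c) \<in> {(a, b, c) \<in> A \<times> B \<times> C.
                u a + v b + w c < mean A u + mean B v + mean C w}.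
             r a b c * f a x * g b y * h c z)))"

end

theory Submission imports Defs
begin

text \<open>
  The one-variable factors of a slice decomposition of length \<open>k\<close> span subspaces of the functions on
  \<open>X\<close>, \<open>Y\<close>, \<open>Z\<close> of dimensions \<open>s + q + p \<le> k\<close>. Extend bases of these subspaces to bases of
  all functions, and give weight \<open>-1\<close> to the basis vectors of the subspaces and weight \<open>0\<close> to the
  other ones. Every monomial that occurs in \<open>F\<close> has a factor from one of the subspaces, so its
  weight is at most \<open>-1\<close>, while the sum of the means is
  \<open>-(s / |X| + q / |Y| + p / |Z|) \<ge> -k / min(|X|, |Y|, |Z|) > -1\<close>.
\<close>

definition tensor :: "('x \<Rightarrow> 'k::field) \<Rightarrow> ('y \<Rightarrow> 'k) \<Rightarrow> 'x \<times> 'y \<Rightarrow> 'k" where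
  "tensor u v = (\<lambda>(x, y). u x * v y)"

lemma tensor_apply [simp]: "tensor u v (x, y) = u x * v y"
  by (simp add: tensor_def)

lemma sum_fun_apply: "sum h I x = (\<Sum>i\<in>I. h i x)"
  for h :: "'i \<Rightarrow> 'x \<Rightarrow> 'k::field"
  by (induction I rule: infinite_finite_induct) (simp_all)

lemma subspace_functions_on: "fvs.subspace (functions_on X)"
  by (rule fvs.subspaceI) (auto simp: functions_on_def fscale_def)

lemma tensor_mem_span:
  fixes u :: "'x \<Rightarrow> 'k::field" and v :: "'y \<Rightarrow> 'k"
  assumes "u \<in> fvs.span U" "v \<in> fvs.span V"
  shows "tensor u v \<in> fvs.span {tensor a b |a b. a \<in> U \<and> b \<in> V}" (is "_ \<in> fvs.span ?T")
proof -
  have *: "tensor u b \<in> fvs.span ?T" if "b \<in> V" for b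
    using assms(1)
  proof (induction rule: fvs.span_induct_alt)
    case base
    have "tensor (0 :: 'x \<Rightarrow> 'k) b = 0" by (auto simp: tensor_def fun_eq_iff)
    then show ?case by (simp only: fvs.span_zero)
  next
    case (step c a w)
    have eq: "tensor (fscale c a + w) b = fscale c (tensor a b) + tensor w b"
      by (auto simp: tensor_def fscale_def fun_eq_iff algebra_simps)
    have "tensor a b \<in> ?T" using step(1) that by blast
    then show ?case
      unfolding eq by (intro fvs.span_add fvs.span_scale fvs.span_base step(2))
  qed
  show ?thesis
    using assms(2)
  proof (induction rule: fvs.span_induct_alt)
    case base
    have "tensor u (0 :: 'y \<Rightarrow> 'k) = 0" by (auto simp: tensor_def fun_eq_iff)
    then show ?case by (simp only: fvs.span_zero)
  next
    case (step c b w)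
    have eq: "tensor u (fscale c b + w) = fscale c (tensor u b) + tensor u w"
      by (auto simp: tensor_def fscale_def fun_eq_iff algebra_simps)
    show ?case
      unfolding eq by (intro fvs.span_add fvs.span_scale step(2) *[OF step(1)])
  qed
qed

lemma comp_mem_span:
  fixes p :: "'x \<Rightarrow> 'k::field" and \<pi> :: "'y \<Rightarrow> 'x"
  assumes "p \<in> fvs.span A"
  shows "p \<circ> \<pi> \<in> fvs.span ((\<lambda>a. a \<circ> \<pi>) ` A)"
  using assms
proof (induction rule: fvs.span_induct_alt)
  case base
  have "(0 :: 'x \<Rightarrow> 'k) \<circ> \<pi> = 0" by (auto simp: fun_eq_iff)
  then show ?case by (simp only: fvs.span_zero)
next
  case (step c a w)
  have eq: "(fscale c a + w) \<circ> \<pi> = fscale c (a \<circ> \<pi>) + (w \<circ> \<pi>)"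
    by (auto simp: fscale_def fun_eq_iff)
  show ?case
    unfolding eq by (intro fvs.span_add fvs.span_scale fvs.span_base imageI step)
qed

lemma mem_span_image_coefficients:
  assumes "finite P" "x \<in> fvs.span (e ` P)"
  shows "\<exists>r. \<forall>t. x t = (\<Sum>i\<in>P. r i * e i t)"
  using assms(2)
proof (induction rule: fvs.span_induct_alt)
  case base
  show ?case by (rule exI[of _ "\<lambda>_. 0"]) simp
next
  case (step c a w)
  then obtain j r where j: "j \<in> P" "a = e j" and r: "\<And>t. w t = (\<Sum>i\<in>P. r i * e i t)"
    by auto
  show ?case
  proof (intro exI[of _ "\<lambda>i. r i + (if i = j then c else 0)"] allI)
    fix t
    have "(\<Sum>i\<in>P. (r i + (if i = j then c else 0)) * e i t) =
        (\<Sum>i\<in>P. r i * e i t + (if i = j then c * e i t else 0))"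
      by (rule sum.cong) (auto simp: algebra_simps)
    also have "\<dots> = w t + c * e j t"
      using j assms(1) by (simp add: sum.distrib r)
    finally show "(fscale c a + w) t = (\<Sum>i\<in>P. (r i + (if i = j then c else 0)) * e i t)"
      by (simp add: fscale_def j)
  qed
qed

definition delta :: "'x \<Rightarrow> 'x \<Rightarrow> 'k::field" where
  "delta a = (\<lambda>x. if x = a then 1 else 0)"

lemma functions_on_expand:
  assumes "finite X" "p \<in> functions_on X"
  shows "p = (\<Sum>a\<in>X. fscale (p a) (delta a))"
proof
  fix x
  have "(\<Sum>a\<in>X. fscale (p a) (delta a)) x = (\<Sum>a\<in>X. if x = a then p a else 0)"
    unfolding sum_fun_apply by (rule sum.cong) (auto simp: fscale_def delta_def)
  also have "\<dots> = p x"
    using assms by (auto simp: functions_on_def)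
  finally show "p x = (\<Sum>a\<in>X. fscale (p a) (delta a)) x" ..
qed

lemma span_delta:
  assumes "finite X"
  shows "fvs.span (delta ` X) = (functions_on X :: ('x \<Rightarrow> 'k::field) set)"
proof
  show "fvs.span (delta ` X) \<subseteq> (functions_on X :: ('x \<Rightarrow> 'k) set)"
    by (rule fvs.span_minimal[OF _ subspace_functions_on]) (auto simp: functions_on_def delta_def)
  show "functions_on X \<subseteq> (fvs.span (delta ` X) :: ('x \<Rightarrow> 'k) set)"
  proof
    fix p :: "'x \<Rightarrow> 'k"
    assume "p \<in> functions_on X"
    then have "p = (\<Sum>a\<in>X. fscale (p a) (delta a))"
      by (rule functions_on_expand[OF assms])
    also have "\<dots> \<in> fvs.span (delta ` X)"
      by (intro fvs.span_sum fvs.span_scale fvs.span_base imageI)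
    finally show "p \<in> fvs.span (delta ` X)" .
  qed
qed

lemma inj_delta: "inj_on (delta :: 'x \<Rightarrow> 'x \<Rightarrow> 'k::field) X"
  by (rule inj_onI) (metis delta_def zero_neq_one)

lemma independent_delta:
  assumes "finite X"
  shows "fvs.independent (delta ` X :: ('x \<Rightarrow> 'k::field) set)"
proof (rule fvs.independent_if_scalars_zero)
  fix c :: "('x \<Rightarrow> 'k) \<Rightarrow> 'k" and b :: "'x \<Rightarrow> 'k"
  assume eq: "(\<Sum>d\<in>delta ` X. fscale (c d) d) = 0" and "b \<in> delta ` X"
  then obtain a where a: "a \<in> X" "b = delta a" by auto
  have "(\<Sum>d\<in>delta ` X. fscale (c d) d) a = (\<Sum>d\<in>X. if a = d then c (delta d) else 0)"
    unfolding sum_fun_apply sum.reindex[OF inj_delta]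
    by (rule sum.cong) (auto simp: fscale_def delta_def)
  also have "\<dots> = c b"
    using a assms by simp
  finally show "c b = 0" using eq by simp
qed (use assms in simp)

lemma functions_on_Times_subset_span:
  assumes "finite X" "finite Y" "fvs.span U = functions_on X" "fvs.span V = functions_on Y"
  shows "functions_on (X \<times> Y) \<subseteq> fvs.span {tensor a b |a b. a \<in> U \<and> b \<in> V}"
proof -
  have "delta (x, y) \<in> fvs.span {tensor a b |a b. a \<in> U \<and> b \<in> V}"
    if "x \<in> X" "y \<in> Y" for x y
  proof -
    have "delta (x, y) = tensor (delta x) (delta y)"
      by (auto simp: tensor_def delta_def fun_eq_iff)
    also have "\<dots> \<in> fvs.span {tensor a b |a b. a \<in> U \<and> b \<in> V}"
      using that assms by (intro tensor_mem_span) (auto simp: functions_on_def delta_def)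
    finally show ?thesis .
  qed
  then have "fvs.span (delta ` (X \<times> Y)) \<subseteq> fvs.span {tensor a b |a b. a \<in> U \<and> b \<in> V}"
    by (intro fvs.span_minimal) auto
  then show ?thesis
    using assms by (simp add: span_delta)
qed

lemma adapted_basis:
  fixes \<Phi> :: "('x \<Rightarrow> 'k::field) set"
  assumes "finite X" "finite \<Phi>" "\<Phi> \<subseteq> functions_on X"
  obtains A S :: "nat set" and f :: "nat \<Rightarrow> 'x \<Rightarrow> 'k"
  where "basis_family X A f" "finite A" "card A = card X" "S \<subseteq> A" "card S \<le> card \<Phi>"
    "\<Phi> \<subseteq> fvs.span (f ` S)"
proof -
  obtain B0 where B0: "B0 \<subseteq> \<Phi>" "fvs.independent B0" "\<Phi> \<subseteq> fvs.span B0"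
    using fvs.maximal_independent_subset by metis
  obtain B where B: "B0 \<subseteq> B" "B \<subseteq> functions_on X" "fvs.independent B" "functions_on X \<subseteq> fvs.span B"
    using fvs.maximal_independent_subset_extend B0 assms by (metis subset_trans)
  have span: "fvs.span B = functions_on X"
    using B fvs.span_minimal[OF _ subspace_functions_on] by blast
  have d: "card (delta ` X :: ('x \<Rightarrow> 'k) set) = card X"
    by (rule card_image[OF inj_delta])
  have fin: "finite B" and le: "card B \<le> card X"
    using fvs.independent_span_bound[of "delta ` X" B] B assms d
    by (auto simp: span_delta)
  have "card X \<le> card B"
    using fvs.independent_span_bound[OF fin independent_delta[OF assms(1)]] d
      fvs.span_superset[of "delta ` X"]
    by (auto simp: span_delta[OF assms(1)] span)
  with le have card: "card B = card X" by simp
  obtain f where f: "bij_betw f {0..<card B} B"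
    using ex_bij_betw_nat_finite[OF fin] by blast
  define S where "S = {i \<in> {0..<card B}. f i \<in> B0}"
  have S: "f ` S = B0"
  proof -
    have "B0 \<subseteq> f ` {0..<card B}"
      using f B(1) by (simp add: bij_betw_def)
    then show ?thesis
      by (auto simp: S_def)
  qed
  have "card S = card B0"
  proof -
    have "inj_on f S"
      by (rule inj_on_subset[OF bij_betw_imp_inj_on[OF f]]) (auto simp: S_def)
    then show ?thesis
      using card_image[of f S] S by simp
  qed
  then have "card S \<le> card \<Phi>"
    using B0 assms by (simp add: card_mono)
  moreover have "basis_family X {0..<card B} f"
    using f B span by (auto simp: basis_family_def bij_betw_def)
  ultimately show thesis
    using S B0 card by (intro that[of "{0..<card B}" f S]) (auto simp: S_def)
qed

definition restrict0 :: "'x set \<Rightarrow> ('x \<Rightarrow> 'k::field) \<Rightarrow> 'x \<Rightarrow> 'k" where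
  "restrict0 X p = (\<lambda>x. if x \<in> X then p x else 0)"

lemma restrict0_functions_on [simp]: "restrict0 X p \<in> functions_on X"
  by (simp add: restrict0_def functions_on_def)

lemma adapted_basis_family:
  fixes \<phi> :: "'i \<Rightarrow> 'x \<Rightarrow> 'k::field"
  assumes "finite X" "finite I"
  obtains A S :: "nat set" and f :: "nat \<Rightarrow> 'x \<Rightarrow> 'k"
  where "basis_family X A f" "finite A" "card A = card X" "S \<subseteq> A" "card S \<le> card I"
    "\<And>i. i \<in> I \<Longrightarrow> restrict0 X (\<phi> i) \<in> fvs.span (f ` S)"
proof -
  obtain A S :: "nat set" and f :: "nat \<Rightarrow> 'x \<Rightarrow> 'k"
    where *: "basis_family X A f" "finite A" "card A = card X" "S \<subseteq> A"
      "card S \<le> card ((\<lambda>i. restrict0 X (\<phi> i)) ` I)"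
      "(\<lambda>i. restrict0 X (\<phi> i)) ` I \<subseteq> fvs.span (f ` S)"
    by (rule adapted_basis[of X "(\<lambda>i. restrict0 X (\<phi> i)) ` I"]) (use assms in auto)
  moreover have "card S \<le> card I"
    using *(5) card_image_le[OF assms(2)] by (meson order_trans)
  ultimately show thesis by (intro that[of A f S]) auto
qed

lemma mean_neg_indicator:
  assumes "finite A" "S \<subseteq> A"
  shows "mean A (\<lambda>a. if a \<in> S then -1 else 0) = - real (card S) / real (card A)"
proof -
  have "(\<Sum>a\<in>A. if a \<in> S then -1 else (0::real)) = - real (card S)"
    using assms by (simp add: sum.If_cases Int_absorb1)
  then show ?thesis by (simp add: mean_def)
qed

lemma tensor_functions_on_mem_span:
  assumes "finite Y" "finite Z" "u \<in> fvs.span U"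
    and "fvs.span V = functions_on Y" "fvs.span W = functions_on Z" "K \<in> functions_on (Y \<times> Z)"
  shows "tensor u K \<in> fvs.span {tensor a (tensor b c) |a b c. a \<in> U \<and> b \<in> V \<and> c \<in> W}"
proof -
  have "tensor u K \<in> fvs.span {tensor a d |a d. a \<in> U \<and> d \<in> {tensor b c |b c. b \<in> V \<and> c \<in> W}}"
    using functions_on_Times_subset_span[OF assms(1,2,4,5)] assms by (intro tensor_mem_span) auto
  also have "{tensor a d |a d. a \<in> U \<and> d \<in> {tensor b c |b c. b \<in> V \<and> c \<in> W}} =
      {tensor a (tensor b c) |a b c. a \<in> U \<and> b \<in> V \<and> c \<in> W}"
    by blast
  finally show ?thesis .
qed

theorem theorem4p6:
  fixes X :: "'x set" and Y :: "'y set" and Z :: "'z set"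
    and F :: "'x \<times> 'y \<times> 'z \<Rightarrow> 'k::field"
  assumes "finite X" and "finite Y" and "finite Z"
    and "slice_rank X Y Z F < min (card X) (min (card Y) (card Z))"
  shows "unstable X Y Z F"
proof -
  define k where "k = slice_rank X Y Z F"
  have "slice_decomposition X Y Z F k"
    unfolding k_def slice_rank_def
    by (rule LeastI, rule slice_decomposition_card[OF assms(3)])
  then obtain a b and f1 :: "nat \<Rightarrow> 'x \<times> 'y \<Rightarrow> 'k" and f2 :: "nat \<Rightarrow> 'x \<times> 'z \<Rightarrow> 'k"
    and f3 :: "nat \<Rightarrow> 'y \<times> 'z \<Rightarrow> 'k" and g1 g2 g3
    where ab: "a \<le> b" "b \<le> k" and
      F: "\<forall>x\<in>X. \<forall>y\<in>Y. \<forall>z\<in>Z. F (x, y, z) =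
        (\<Sum>i = 1..a. f1 i (x, y) * g1 i z) + (\<Sum>i = a + 1..b. f2 i (x, z) * g2 i y) +
        (\<Sum>i = b + 1..k. f3 i (y, z) * g3 i x)"
    unfolding slice_decomposition_def
    by (elim exE conjE) (rule that)
  obtain A S :: "nat set" and f :: "nat \<Rightarrow> 'x \<Rightarrow> 'k" where A: "basis_family X A f" "finite A" "card A = card X" "S \<subseteq> A"
      "card S \<le> card {b + 1..k}" "\<And>i. i \<in> {b + 1..k} \<Longrightarrow> restrict0 X (g3 i) \<in> fvs.span (f ` S)"
    by (rule adapted_basis_family[OF assms(1) finite_atLeastAtMost, where \<phi> = g3]) (rule that)
  obtain B T :: "nat set" and g :: "nat \<Rightarrow> 'y \<Rightarrow> 'k" where B: "basis_family Y B g" "finite B" "card B = card Y" "T \<subseteq> B"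
      "card T \<le> card {a + 1..b}" "\<And>i. i \<in> {a + 1..b} \<Longrightarrow> restrict0 Y (g2 i) \<in> fvs.span (g ` T)"
    by (rule adapted_basis_family[OF assms(2) finite_atLeastAtMost, where \<phi> = g2]) (rule that)
  obtain C R :: "nat set" and h :: "nat \<Rightarrow> 'z \<Rightarrow> 'k" where C: "basis_family Z C h" "finite C" "card C = card Z" "R \<subseteq> C"
      "card R \<le> card {1..a}" "\<And>i. i \<in> {1..a} \<Longrightarrow> restrict0 Z (g1 i) \<in> fvs.span (h ` R)"
    by (rule adapted_basis_family[OF assms(3) finite_atLeastAtMost, where \<phi> = g1]) (rule that)
  have spans: "fvs.span (f ` A) = functions_on X" "fvs.span (g ` B) = functions_on Y"
    "fvs.span (h ` C) = functions_on Z"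
    using A B C by (auto simp: basis_family_def)

  define e where "e = (\<lambda>(i, j, l). tensor (f i) (tensor (g j) (h l)))"
  define P where "P = {(i, j, l) \<in> A \<times> B \<times> C. i \<in> S \<or> j \<in> T \<or> l \<in> R}"
  have "finite P"
    by (rule finite_subset[of _ "A \<times> B \<times> C"]) (use A B C in \<open>auto simp: P_def\<close>)
  have eP: "tensor (f i) (tensor (g j) (h l)) \<in> e ` P"
    if "i \<in> A" "j \<in> B" "l \<in> C" "i \<in> S \<or> j \<in> T \<or> l \<in> R" for i j l
    using that by (auto simp: e_def P_def intro!: rev_image_eqI[of "(i, j, l)"])

  have s3: "tensor (restrict0 X (g3 i)) (restrict0 (Y \<times> Z) (f3 i)) \<in> fvs.span (e ` P)"
    if "i \<in> {b + 1..k}" for i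
  proof -
    have "tensor (restrict0 X (g3 i)) (restrict0 (Y \<times> Z) (f3 i)) \<in> fvs.span
        {tensor p (tensor q s) |p q s. p \<in> f ` S \<and> q \<in> g ` B \<and> s \<in> h ` C}"
      using A that spans assms by (intro tensor_functions_on_mem_span) auto
    moreover have "{tensor p (tensor q s) |p q s. p \<in> f ` S \<and> q \<in> g ` B \<and> s \<in> h ` C} \<subseteq> e ` P"
      using A(4) by (auto intro!: eP)
    ultimately show ?thesis
      by (meson fvs.span_mono subsetD)
  qed
  have s2: "tensor (restrict0 Y (g2 i)) (restrict0 (X \<times> Z) (f2 i)) \<circ> (\<lambda>(x, y, z). (y, x, z))
      \<in> fvs.span (e ` P)" (is "_ \<circ> ?\<pi> \<in> _")
    if "i \<in> {a + 1..b}" for i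
  proof -
    have swap: "tensor p (tensor q s) \<circ> ?\<pi> = tensor q (tensor p s)"
      for p and q :: "'x \<Rightarrow> 'k" and s
      by (auto simp: tensor_def fun_eq_iff)
    have "tensor (restrict0 Y (g2 i)) (restrict0 (X \<times> Z) (f2 i)) \<in> fvs.span
        {tensor p (tensor q s) |p q s. p \<in> g ` T \<and> q \<in> f ` A \<and> s \<in> h ` C}"
      using B that spans assms by (intro tensor_functions_on_mem_span) auto
    then have "tensor (restrict0 Y (g2 i)) (restrict0 (X \<times> Z) (f2 i)) \<circ> ?\<pi> \<in> fvs.span
        ((\<lambda>a. a \<circ> ?\<pi>) ` {tensor p (tensor q s) |p q s. p \<in> g ` T \<and> q \<in> f ` A \<and> s \<in> h ` C})"
      by (rule comp_mem_span)
    moreover have "(\<lambda>a. a \<circ> ?\<pi>) ` {tensor p (tensor q s) |p q s. p \<in> g ` T \<and> q \<in> f ` A \<and> s \<in> h ` C}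
        \<subseteq> e ` P"
    proof (rule image_subsetI)
      fix d
      assume "d \<in> {tensor p (tensor q s) |p q s. p \<in> g ` T \<and> q \<in> f ` A \<and> s \<in> h ` C}"
      then obtain i j l where "j \<in> T" "i \<in> A" "l \<in> C" and d: "d = tensor (g j) (tensor (f i) (h l))"
        by blast
      then have "tensor (f i) (tensor (g j) (h l)) \<in> e ` P"
        using B(4) by (intro eP) auto
      then show "d \<circ> ?\<pi> \<in> e ` P"
        unfolding d swap .
    qed
    ultimately show ?thesis
      by (meson fvs.span_mono subsetD)
  qed
  have s1: "tensor (restrict0 Z (g1 i)) (restrict0 (X \<times> Y) (f1 i)) \<circ> (\<lambda>(x, y, z). (z, x, y))
      \<in> fvs.span (e ` P)" (is "_ \<circ> ?\<pi> \<in> _")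
    if "i \<in> {1..a}" for i
  proof -
    have swap: "tensor p (tensor q s) \<circ> ?\<pi> = tensor q (tensor s p)"
      for p and q :: "'x \<Rightarrow> 'k" and s
      by (auto simp: tensor_def fun_eq_iff)
    have "tensor (restrict0 Z (g1 i)) (restrict0 (X \<times> Y) (f1 i)) \<in> fvs.span
        {tensor p (tensor q s) |p q s. p \<in> h ` R \<and> q \<in> f ` A \<and> s \<in> g ` B}"
      using C that spans assms by (intro tensor_functions_on_mem_span) auto
    then have "tensor (restrict0 Z (g1 i)) (restrict0 (X \<times> Y) (f1 i)) \<circ> ?\<pi> \<in> fvs.span
        ((\<lambda>a. a \<circ> ?\<pi>) ` {tensor p (tensor q s) |p q s. p \<in> h ` R \<and> q \<in> f ` A \<and> s \<in> g ` B})"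
      by (rule comp_mem_span)
    moreover have "(\<lambda>a. a \<circ> ?\<pi>) ` {tensor p (tensor q s) |p q s. p \<in> h ` R \<and> q \<in> f ` A \<and> s \<in> g ` B}
        \<subseteq> e ` P"
    proof (rule image_subsetI)
      fix d
      assume "d \<in> {tensor p (tensor q s) |p q s. p \<in> h ` R \<and> q \<in> f ` A \<and> s \<in> g ` B}"
      then obtain i j l where "l \<in> R" "i \<in> A" "j \<in> B" and d: "d = tensor (h l) (tensor (f i) (g j))"
        by blast
      then have "tensor (f i) (tensor (g j) (h l)) \<in> e ` P"
        using C(4) by (intro eP) auto
      then show "d \<circ> ?\<pi> \<in> e ` P"
        unfolding d swap .
    qed
    ultimately show ?thesis
      by (meson fvs.span_mono subsetD)
  qed

  define G where "G =
    (\<Sum>i = 1..a. tensor (restrict0 Z (g1 i)) (restrict0 (X \<times> Y) (f1 i)) \<circ> (\<lambda>(x, y, z). (z, x, y))) +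
    (\<Sum>i = a + 1..b. tensor (restrict0 Y (g2 i)) (restrict0 (X \<times> Z) (f2 i)) \<circ> (\<lambda>(x, y, z). (y, x, z))) +
    (\<Sum>i = b + 1..k. tensor (restrict0 X (g3 i)) (restrict0 (Y \<times> Z) (f3 i)))"
  have "G \<in> fvs.span (e ` P)"
    unfolding G_def by (intro fvs.span_add fvs.span_sum s1 s2 s3)
  then obtain r where r: "\<And>t. G t = (\<Sum>i\<in>P. r i * e i t)"
    using mem_span_image_coefficients[OF \<open>finite P\<close>] by blast
  have FG: "F (x, y, z) = G (x, y, z)" if "x \<in> X" "y \<in> Y" "z \<in> Z" for x y z
    using that by (simp add: F G_def sum_fun_apply restrict0_def mult.commute)

  define weight :: "nat set \<Rightarrow> nat \<Rightarrow> real" where "weight = (\<lambda>S i. if i \<in> S then -1 else 0)"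
  define n where "n = min (card X) (min (card Y) (card Z))"
  have n: "k < n" "n \<le> card X" "n \<le> card Y" "n \<le> card Z"
    using assms(4) by (auto simp: n_def k_def)
  have mean: "mean A (weight S) + mean B (weight T) + mean C (weight R) > -1"
  proof -
    have "card S + card T + card R \<le> k"
      using A(5) B(5) C(5) ab by simp
    then have "real (card S) / n + real (card T) / n + real (card R) / n < 1"
      using n(1) by (simp flip: add_divide_distrib)
    moreover have "real (card S) / card X \<le> real (card S) / n"
      "real (card T) / card Y \<le> real (card T) / n" "real (card R) / card Z \<le> real (card R) / n"
      using n by (auto intro!: divide_left_mono)
    ultimately show ?thesis
      using A B C by (simp add: weight_def mean_neg_indicator)
  qed
  define Q where "Q = {(i, j, l) \<in> A \<times> B \<times> C. weight S i + weight T j + weight R l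
      < mean A (weight S) + mean B (weight T) + mean C (weight R)}"
  have "P \<subseteq> Q"
    using mean by (auto simp: P_def Q_def weight_def)
  have "finite Q"
    by (rule finite_subset[of _ "A \<times> B \<times> C"]) (use A B C in \<open>auto simp: Q_def\<close>)
  have "F (x, y, z) = (\<Sum>(i, j, l)\<in>Q. (if (i, j, l) \<in> P then r (i, j, l) else 0) * f i x * g j y * h l z)"
    if "x \<in> X" "y \<in> Y" "z \<in> Z" for x y z
    unfolding FG[OF that] r
    by (rule sum.mono_neutral_cong_left[OF \<open>finite Q\<close> \<open>P \<subseteq> Q\<close>])
      (auto simp: e_def mult.assoc)
  then show ?thesis
    unfolding unstable_def Q_def using A(1) B(1) C(1)
    by (intro exI[of _ A] exI[of _ B] exI[of _ C] exI[of _ f] exI[of _ g] exI[of _ h]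
        exI[of _ "weight S"] exI[of _ "weight T"] exI[of _ "weight R"]
        exI[of _ "\<lambda>i j l. if (i, j, l) \<in> P then r (i, j, l) else 0"] conjI ballI)
qed

end
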